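(* Let $E$ be a fixed orthonormal basis of $\mathbb{C}^n$ and let $S$ and $V$ be subspaces of $\mathbb{C}^n$ with $\{0\}\subsetneq S\subsetneq\mathbb{C}^n$ and $\{0\}\subsetneq V\subsetneq\mathbb{C}^n$. If $\|P_S-P_V\|<\frac{1}{2n}$, then $$\operatorname{dist}_H(m_S,m_V)=\max\Big\{\sup_{x\in m_S}\operatorname{dist}(x,m_V),\ \sup_{z\in m_V}\operatorname{dist}(z,m_S)\Big\}\le(2\sqrt{n}+1)\,\|P_S-P_V\|.$$
   Context: For $x\in\mathbb{C}^n$ and $E=\{e_1,\dots,e_n\}$ put $x_j=\langle x,e_j\rangle$ and $|x|^2=(|x_1|^2,\dots,|x_n|^2)$. For a subspace $S$, $P_S$ is the orthogonal projection onto $S$, and the moment of $S$ is $m_S=\operatorname{conv}\{|v|^2:v\in S,\ \|v\|=1\}\subset\mathbb{R}^n_{\ge0}$. $\|P_S-P_V\|$ is the spectral (operator) norm, $\operatorname{dist}$ is the Euclidean distance in $\mathbb{R}^n$ and $\operatorname{dist}_H$ is the Hausdorff distance. *)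

theory Defs
  imports "HOL-Analysis.Analysis"
begin

text \<open>
  The library inner product on \<^typ>\<open>complex ^ 'n\<close> is the real one (the real part of the one below).
  Its norm is the Hermitian norm, see \<open>norm_eq_sqrt_cinner\<close>.
\<close>

definition cinner :: "complex ^ 'n \<Rightarrow> complex ^ 'n \<Rightarrow> complex" where
  "cinner x y = (\<Sum>i\<in>UNIV. x $ i * cnj (y $ i))"

lemma norm_eq_sqrt_cinner: "complex_of_real ((norm x)\<^sup>2) = cinner x x"
  by (simp add: cinner_def norm_vec_def L2_set_def sum_nonneg complex_norm_square
      del: of_real_power)

definition is_orthonormal_basis :: "('n \<Rightarrow> complex ^ 'n) \<Rightarrow> bool" where
  "is_orthonormal_basis e \<longleftrightarrow>
     (\<forall>i j. cinner (e i) (e j) = (if i = j then 1 else 0)) \<and> vec.span (range e) = UNIV"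

text \<open>For a complex subspace \<open>S\<close> the vector described here exists and is unique.\<close>

definition orth_proj :: "(complex ^ 'n) set \<Rightarrow> complex ^ 'n \<Rightarrow> complex ^ 'n" where
  "orth_proj S x = (THE y. y \<in> S \<and> (\<forall>s\<in>S. cinner (x - y) s = 0))"

definition abs_sq :: "('n \<Rightarrow> complex ^ 'n) \<Rightarrow> complex ^ 'n \<Rightarrow> real ^ 'n" where
  "abs_sq e x = (\<chi> j. (cmod (cinner x (e j)))\<^sup>2)"

definition moment :: "('n \<Rightarrow> complex ^ 'n) \<Rightarrow> (complex ^ 'n) set \<Rightarrow> (real ^ 'n) set" where
  "moment e S = convex hull {abs_sq e v | v. v \<in> S \<and> norm v = 1}"

text \<open>
  Only meaningful for nonempty bounded sets: \<^const>\<open>infdist\<close> to the empty set is \<open>0\<close>, and the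
  real-valued suprema are unspecified for unbounded sets.  The moments of nonzero subspaces
  are nonempty and bounded.
\<close>

definition hausdorff_dist :: "'a::metric_space set \<Rightarrow> 'a set \<Rightarrow> real" where
  "hausdorff_dist A B = max (SUP x\<in>A. infdist x B) (SUP z\<in>B. infdist z A)"

end

theory Submission
  imports Defs
begin

text \<open>
  Every generator \<open>|v|\<^sup>2\<close> of \<open>m\<^sub>S\<close> is within \<open>3 \<parallel>P\<^sub>S - P\<^sub>V\<parallel>\<close> of \<open>m\<^sub>V\<close>: for \<open>w = P\<^sub>V v\<close> and
  \<open>\<delta> = \<parallel>P\<^sub>S - P\<^sub>V\<parallel> < 1\<close> we have \<open>\<parallel>v - w\<parallel> \<le> \<delta>\<close>, so \<open>w \<noteq> 0\<close>, and \<open>|v|\<^sup>2\<close> and \<open>|w|\<^sup>2\<close> differ by at most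
  \<open>\<parallel>v - w\<parallel> (\<parallel>v\<parallel> + \<parallel>w\<parallel>) \<le> 2 \<delta>\<close>. Normalising \<open>w\<close> moves \<open>|w|\<^sup>2\<close> by at most
  \<open>1 - \<parallel>w\<parallel>\<^sup>2 = \<parallel>v - w\<parallel>\<^sup>2 \<le> \<delta>\<close>. The estimate passes to the convex hulls since a closed ball is
  convex, and \<open>3 \<le> 2 \<surd>n + 1\<close>.
\<close>

section \<open>Algebra of the Hermitian form\<close>

lemma cinner_add_left: "cinner (x + y) z = cinner x z + cinner y z"
  by (simp add: cinner_def distrib_right sum.distrib)

lemma cinner_diff_left: "cinner (x - y) z = cinner x z - cinner y z"
  by (simp add: cinner_def left_diff_distrib sum_subtractf)

lemma cinner_vscale_left: "cinner (c *s x) y = c * cinner x y"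
  by (simp add: cinner_def sum_distrib_left mult_ac)

lemma cinner_vscale_right: "cinner x (c *s y) = cnj c * cinner x y"
  by (simp add: cinner_def sum_distrib_left mult_ac)

lemma scaleR_eq_vscale: "r *\<^sub>R (x :: complex ^ 'n) = complex_of_real r *s x"
  unfolding vec_eq_iff vector_scaleR_component vector_smult_component
  by (simp add: scaleR_conv_of_real)

lemma cinner_scaleR_left: "cinner (r *\<^sub>R x) y = complex_of_real r * cinner x y"
  by (simp add: scaleR_eq_vscale cinner_vscale_left)

lemma cinner_sum_left: "cinner (\<Sum>i\<in>A. f i) y = (\<Sum>i\<in>A. cinner (f i) y)"
  unfolding cinner_def sum_component sum_distrib_right by (rule sum.swap)

lemma cnj_cinner: "cnj (cinner x y) = cinner y x"
  by (simp add: cinner_def mult.commute)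

lemma inner_eq_Re_cinner: "x \<bullet> y = Re (cinner x y)"
  by (simp add: inner_vec_def cinner_def inner_complex_def)

lemma norm_sq_eq_Re_cinner: "(norm x)\<^sup>2 = Re (cinner x x)"
  by (metis norm_eq_sqrt_cinner Re_complex_of_real)

text \<open>Pythagoras for \<open>x = (x - y) + y\<close>: the real inner product is the real part
  of \<open>cinner\<close>, so it vanishes too. Used for Bessel's inequality and for
  projections.\<close>

lemma norm_sq_eq_if_cinner_eq_0:
  assumes "cinner (x - y) y = 0"
  shows "(norm x)\<^sup>2 = (norm y)\<^sup>2 + (norm (x - y))\<^sup>2"
  using norm_add_Pythagorean[of "x - y" y] assms
  by (simp add: orthogonal_def inner_eq_Re_cinner)

section \<open>Coordinate estimates for \<open>abs_sq\<close>\<close>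

lemma bessel_inequality:
  fixes e :: "'n::finite \<Rightarrow> complex ^ 'n"
  assumes e: "is_orthonormal_basis e"
  shows "L2_set (\<lambda>j. cmod (cinner x (e j))) UNIV \<le> norm x"
proof -
  \<comment> \<open>\<open>p\<close> is the Fourier expansion of \<open>x\<close>. All coefficients
    of \<open>x - p\<close> vanish, so \<open>x - p\<close> is orthogonal to \<open>p\<close>, and
    Pythagoras leaves the sum of squared coefficients, \<open>(norm p)\<^sup>2\<close>, below
    \<open>(norm x)\<^sup>2\<close>.\<close>
  define p where "p = (\<Sum>j\<in>UNIV. cinner x (e j) *s e j)"
  have orthonormal: "cinner (e i) (e j) = (if i = j then 1 else 0)" for i j
    using e by (simp add: is_orthonormal_basis_def)
  have coeff: "cinner p (e k) = cinner x (e k)" for k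
    by (simp add: p_def cinner_sum_left cinner_vscale_left orthonormal if_distrib cong: if_cong)
  have expand: "cinner y p = (\<Sum>j\<in>UNIV. cnj (cinner x (e j)) * cinner y (e j))" for y
  proof -
    have "cinner y p = cnj (\<Sum>j\<in>UNIV. cinner x (e j) * cinner (e j) y)"
      unfolding p_def by (subst cnj_cinner[symmetric]) (simp add: cinner_sum_left cinner_vscale_left)
    then show ?thesis by (simp add: cnj_cinner)
  qed
  have "cinner (x - p) p = 0"
    unfolding expand by (simp add: cinner_diff_left coeff)
  then have "(norm x)\<^sup>2 = (norm p)\<^sup>2 + (norm (x - p))\<^sup>2"
    by (rule norm_sq_eq_if_cinner_eq_0)
  moreover have "(norm p)\<^sup>2 = (\<Sum>j\<in>UNIV. (cmod (cinner x (e j)))\<^sup>2)"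
    unfolding norm_sq_eq_Re_cinner expand coeff cmod_power2
    by (simp add: power2_eq_square)
  ultimately have "(\<Sum>j\<in>UNIV. (cmod (cinner x (e j)))\<^sup>2) \<le> (norm x)\<^sup>2"
    by simp
  then show ?thesis
    unfolding L2_set_def by (simp add: real_le_lsqrt sum_nonneg)
qed

lemma norm_abs_sq_le:
  assumes "is_orthonormal_basis e"
  shows "norm (abs_sq e x) \<le> (norm x)\<^sup>2"
proof -
  have "norm (abs_sq e x) \<le> (\<Sum>j\<in>UNIV. (cmod (cinner x (e j)))\<^sup>2)"
    using norm_le_l1_cart[of "abs_sq e x"] by (simp add: abs_sq_def)
  also have "\<dots> = (L2_set (\<lambda>j. cmod (cinner x (e j))) UNIV)\<^sup>2"
    by (simp add: L2_set_def sum_nonneg)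
  also have "\<dots> \<le> (norm x)\<^sup>2"
    by (rule power_mono[OF bessel_inequality[OF assms]]) simp
  finally show ?thesis .
qed

text \<open>The Euclidean norm is bounded by the l1 norm. There each difference of squares factors,
  the reverse triangle inequality bounds one factor by a coefficient of \<open>x - y\<close>, and
  Cauchy-Schwarz followed by Bessel gives a bound free of the dimension.\<close>

lemma norm_abs_sq_diff_le:
  fixes e :: "'n::finite \<Rightarrow> complex ^ 'n"
  assumes e: "is_orthonormal_basis e"
  shows "norm (abs_sq e x - abs_sq e y) \<le> norm (x - y) * (norm x + norm y)"
proof -
  define c where "c = (\<lambda>z j. cmod (cinner z (e j)))"
  have "norm (abs_sq e x - abs_sq e y) \<le> (\<Sum>j\<in>UNIV. \<bar>(c x j)\<^sup>2 - (c y j)\<^sup>2\<bar>)"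
    using norm_le_l1_cart[of "abs_sq e x - abs_sq e y"] by (simp add: abs_sq_def c_def)
  also have "\<dots> \<le> (\<Sum>j\<in>UNIV. \<bar>c (x - y) j\<bar> * \<bar>c x j + c y j\<bar>)"
  proof (rule sum_mono)
    fix j
    have "\<bar>(c x j)\<^sup>2 - (c y j)\<^sup>2\<bar> = \<bar>c x j - c y j\<bar> * \<bar>c x j + c y j\<bar>"
      by (simp add: power2_eq_square square_diff_square_factored abs_mult mult.commute)
    also have "\<dots> \<le> \<bar>c (x - y) j\<bar> * \<bar>c x j + c y j\<bar>"
      by (rule mult_right_mono) (simp_all add: c_def cinner_diff_left norm_triangle_ineq3)
    finally show "\<bar>(c x j)\<^sup>2 - (c y j)\<^sup>2\<bar> \<le> \<bar>c (x - y) j\<bar> * \<bar>c x j + c y j\<bar>" .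
  qed
  also have "\<dots> \<le> L2_set (c (x - y)) UNIV * L2_set (\<lambda>j. c x j + c y j) UNIV"
    by (rule L2_set_mult_ineq)
  also have "\<dots> \<le> norm (x - y) * (norm x + norm y)"
  proof (rule mult_mono)
    have "L2_set (\<lambda>j. c x j + c y j) UNIV \<le> L2_set (c x) UNIV + L2_set (c y) UNIV"
      by (rule L2_set_triangle_ineq)
    also have "\<dots> \<le> norm x + norm y"
      unfolding c_def by (intro add_mono bessel_inequality[OF e])
    finally show "L2_set (\<lambda>j. c x j + c y j) UNIV \<le> norm x + norm y" .
  qed (auto simp: c_def bessel_inequality[OF e] L2_set_nonneg)
  finally show ?thesis .
qed

lemma abs_sq_scaleR: "abs_sq e (r *\<^sub>R x) = r\<^sup>2 *\<^sub>R abs_sq e x"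
  by (simp add: vec_eq_iff abs_sq_def cinner_scaleR_left norm_mult power_mult_distrib)

section \<open>Orthogonal projections onto complex subspaces\<close>

lemma complex_subspace_imp_subspace:
  fixes S :: "(complex ^ 'n::finite) set"
  assumes "vec.subspace S"
  shows "subspace S"
  using assms unfolding subspace_def vec.subspace_def by (simp add: scaleR_eq_vscale)

text \<open>Justifies the \<open>THE\<close> in \<open>orth_proj\<close>. Existence comes from the
  real orthogonal decomposition; for uniqueness, the difference of two candidates lies in
  \<open>S\<close> and is orthogonal to itself.\<close>

lemma ex1_orth_proj:
  fixes S :: "(complex ^ 'n::finite) set"
  assumes S: "vec.subspace S"
  shows "\<exists>!y. y \<in> S \<and> (\<forall>s\<in>S. cinner (x - y) s = 0)"
proof (rule ex_ex1I)
  have real_span: "span S = S"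
    using complex_subspace_imp_subspace[OF S] by simp
  obtain y z where y: "y \<in> S" and z: "\<And>s. s \<in> S \<Longrightarrow> orthogonal z s" and x: "x = y + z"
    using orthogonal_subspace_decomp_exists[of S x] real_span by metis
  have "cinner (x - y) s = 0" if "s \<in> S" for s
  proof -
    \<comment> \<open>A complex subspace is closed under multiplication by \<open>\<i>\<close>, so real orthogonality to it
      also kills the imaginary part.\<close>
    have "\<i> *s s \<in> S"
      using S that by (rule vec.subspace_scale)
    then have "Re (cinner z s) = 0" "Re (cinner z (\<i> *s s)) = 0"
      using z that by (auto simp: orthogonal_def inner_eq_Re_cinner)
    then show ?thesis
      by (simp add: x cinner_vscale_right complex_eq_iff)
  qed
  with y show "\<exists>y. y \<in> S \<and> (\<forall>s\<in>S. cinner (x - y) s = 0)" by blast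
next
  fix y y'
  assume y: "y \<in> S \<and> (\<forall>s\<in>S. cinner (x - y) s = 0)" and y': "y' \<in> S \<and> (\<forall>s\<in>S. cinner (x - y') s = 0)"
  then have "y - y' \<in> S"
    using vec.subspace_diff[OF S] by blast
  \<comment> \<open>The left argument is just \<open>y - y'\<close>, written so that both
    orthogonality assumptions apply.\<close>
  then have "cinner ((x - y') - (x - y)) (y - y') = 0"
    using y y' by (simp only: cinner_diff_left) simp
  then have "(norm (y - y'))\<^sup>2 = 0"
    by (simp add: norm_sq_eq_Re_cinner)
  then show "y = y'" by simp
qed

lemma orth_proj_mem:
  assumes "vec.subspace S"
  shows "orth_proj S x \<in> S"
  using theI'[OF ex1_orth_proj[OF assms, of x]] unfolding orth_proj_def by blast

lemma cinner_orth_proj_eq_0: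
  assumes "vec.subspace S" "s \<in> S"
  shows "cinner (x - orth_proj S x) s = 0"
  using theI'[OF ex1_orth_proj[OF assms(1), of x]] assms(2) unfolding orth_proj_def by blast

lemma orth_proj_eqI:
  assumes "vec.subspace S" "y \<in> S" "\<And>s. s \<in> S \<Longrightarrow> cinner (x - y) s = 0"
  shows "orth_proj S x = y"
  unfolding orth_proj_def using assms ex1_orth_proj[OF assms(1), of x]
  by (intro the1_equality) auto

lemma orth_proj_ident:
  assumes "vec.subspace S" "x \<in> S"
  shows "orth_proj S x = x"
  using assms by (intro orth_proj_eqI) (auto simp: cinner_def)

lemma bounded_linear_orth_proj:
  assumes S: "vec.subspace S"
  shows "bounded_linear (orth_proj S)"
proof -
  have "linear (orth_proj S)"
  proof (rule linearI)
    fix x y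
    have "cinner (x + y - (orth_proj S x + orth_proj S y)) s = 0" if "s \<in> S" for s
      unfolding add_diff_add cinner_add_left by (simp add: cinner_orth_proj_eq_0[OF S that])
    then show "orth_proj S (x + y) = orth_proj S x + orth_proj S y"
      using S by (intro orth_proj_eqI) (auto intro: vec.subspace_add orth_proj_mem)
  next
    fix r x
    have "cinner (r *\<^sub>R x - r *\<^sub>R orth_proj S x) s = 0" if "s \<in> S" for s
      unfolding scaleR_diff_right[symmetric] cinner_scaleR_left
      by (simp add: cinner_orth_proj_eq_0[OF S that])
    then show "orth_proj S (r *\<^sub>R x) = r *\<^sub>R orth_proj S x"
      using S by (intro orth_proj_eqI)
        (auto simp: scaleR_eq_vscale intro: vec.subspace_scale orth_proj_mem)
  qed
  then show ?thesis
    by (simp add: linear_conv_bounded_linear)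
qed

section \<open>Distances between moments\<close>

lemma ex_near_in_moment:
  fixes e :: "'n::finite \<Rightarrow> complex ^ 'n"
  assumes e: "is_orthonormal_basis e" and V: "vec.subspace V"
    and v: "norm v = 1" and near: "norm (v - orth_proj V v) \<le> d" and d: "d < 1"
  obtains z where "z \<in> moment e V" "norm (abs_sq e v - z) \<le> 3 * d"
proof -
  define w where "w = orth_proj V v"
  define u where "u = (1 / norm w) *\<^sub>R w"
  have "0 \<le> d"
    using near norm_ge_zero order_trans by blast
  have w: "w \<in> V"
    unfolding w_def using V by (rule orth_proj_mem)
  have vw: "norm (v - w) \<le> d"
    using near by (simp add: w_def)
  have pyth: "1 = (norm w)\<^sup>2 + (norm (v - w))\<^sup>2"
    using norm_sq_eq_if_cinner_eq_0[of v w] cinner_orth_proj_eq_0[OF V w] v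
    by (simp add: w_def)
  \<comment> \<open>One factor of the square is at most 1 and the other at most
    \<open>d\<close>.\<close>
  have "(norm (v - w))\<^sup>2 \<le> d"
    using vw d \<open>0 \<le> d\<close> mult_mono[of "norm (v - w)" 1 "norm (v - w)" d] by (simp add: power2_eq_square)
  then have gap: "1 - (norm w)\<^sup>2 \<le> d"
    using pyth by simp
  have "(norm w)\<^sup>2 \<le> 1\<^sup>2"
    using pyth by (metis le_add_same_cancel1 one_power2 zero_le_power2)
  then have w1: "norm w \<le> 1"
    by (rule power2_le_imp_le) simp
  have w0: "0 < norm w"
    using vw d v by auto
  have "u \<in> V"
    unfolding u_def scaleR_eq_vscale using V w by (rule vec.subspace_scale)
  moreover have "norm u = 1"
    using w0 by (simp add: u_def)
  ultimately have "abs_sq e u \<in> moment e V"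
    unfolding moment_def by (blast intro: hull_inc)
  moreover have "norm (abs_sq e v - abs_sq e u) \<le> 3 * d"
  proof -
    have "norm (abs_sq e v - abs_sq e w) \<le> norm (v - w) * (norm v + norm w)"
      by (rule norm_abs_sq_diff_le[OF e])
    also have "\<dots> \<le> d * 2"
      using vw v w1 \<open>0 \<le> d\<close> by (intro mult_mono) auto
    finally have "norm (abs_sq e v - abs_sq e w) \<le> 2 * d" by simp
    moreover have "norm (abs_sq e w - abs_sq e u) \<le> d"
    proof -
      \<comment> \<open>\<open>abs_sq e\<close> is homogeneous of degree 2, so
        \<open>abs_sq e w\<close> is a multiple of \<open>abs_sq e u\<close>, whose norm is at most
        1.\<close>
      have "w = norm w *\<^sub>R u"
        using w0 by (simp add: u_def)
      then have "abs_sq e w = (norm w)\<^sup>2 *\<^sub>R abs_sq e u"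
        by (metis abs_sq_scaleR)
      then have "norm (abs_sq e w - abs_sq e u) = \<bar>(norm w)\<^sup>2 - 1\<bar> * norm (abs_sq e u)"
        by (metis norm_scaleR scaleR_left_diff_distrib scaleR_one)
      also have "\<dots> \<le> d * 1"
        using gap \<open>(norm w)\<^sup>2 \<le> 1\<^sup>2\<close> norm_abs_sq_le[OF e, of u] \<open>norm u = 1\<close> \<open>0 \<le> d\<close>
        by (intro mult_mono) auto
      finally show ?thesis by simp
    qed
    ultimately show ?thesis
      using norm_triangle_ineq[of "abs_sq e v - abs_sq e w" "abs_sq e w - abs_sq e u"] by simp
  qed
  ultimately show ?thesis by (rule that)
qed

text \<open>The Minkowski sum of \<open>B\<close> and \<open>cball 0 r\<close> is convex and
  contains \<open>A\<close>, hence also the hull of \<open>A\<close>.\<close>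

lemma infdist_convex_hull_le:
  fixes A B :: "'a::real_normed_vector set"
  assumes B: "convex B" and near: "\<And>a. a \<in> A \<Longrightarrow> \<exists>b\<in>B. norm (a - b) \<le> r"
    and x: "x \<in> convex hull A"
  shows "infdist x B \<le> r"
proof -
  let ?N = "\<Union>b\<in>B. \<Union>y\<in>cball 0 r. {b + y}"
  have "A \<subseteq> ?N"
  proof
    fix a assume "a \<in> A"
    then obtain b where "b \<in> B" "norm (a - b) \<le> r"
      using near by blast
    moreover have "a = b + (a - b)" by simp
    ultimately show "a \<in> ?N"
      by (metis UN_I mem_cball_0 singletonI)
  qed
  moreover have "convex ?N"
    by (rule convex_sums[OF B convex_cball])
  ultimately have "convex hull A \<subseteq> ?N"
    by (rule hull_minimal)
  then have "x \<in> ?N"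
    using x by (rule subsetD)
  then obtain b y where "b \<in> B" "norm y \<le> r" "x = b + y"
    by auto
  then show ?thesis
    using infdist_le2[of b B x r] by (simp add: dist_norm)
qed

lemma SUP_infdist_moment_le:
  fixes e :: "'n::finite \<Rightarrow> complex ^ 'n"
  assumes e: "is_orthonormal_basis e"
    and S: "vec.subspace S" "{0} \<subset> S" and V: "vec.subspace V"
    and d: "onorm (\<lambda>x. orth_proj S x - orth_proj V x) < 1"
  shows "(SUP x\<in>moment e S. infdist x (moment e V))
           \<le> 3 * onorm (\<lambda>x. orth_proj S x - orth_proj V x)"
proof (rule cSUP_least)
  let ?d = "onorm (\<lambda>x. orth_proj S x - orth_proj V x)"
  \<comment> \<open>Normalising a nonzero vector of \<open>S\<close> shows that the supremum ranges
    over a nonempty set, as \<open>cSUP_least\<close> requires.\<close>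
  obtain s where s: "s \<in> S" "s \<noteq> 0"
    using S(2) by blast
  then have "(1 / norm s) *\<^sub>R s \<in> S"
    using S(1) by (simp add: scaleR_eq_vscale vec.subspace_scale)
  moreover have "norm ((1 / norm s) *\<^sub>R s) = 1"
    using s by simp
  ultimately have "{abs_sq e v |v. v \<in> S \<and> norm v = 1} \<noteq> {}"
    by blast
  then show "moment e S \<noteq> {}"
    by (simp add: moment_def)
  fix x assume "x \<in> moment e S"
  then show "infdist x (moment e V) \<le> 3 * ?d"
    unfolding moment_def[of e S]
  \<comment> \<open>The rotation puts the membership premise first, where the chained fact
    discharges it.\<close>
  proof (rule infdist_convex_hull_le[rotated 2])
    show "convex (moment e V)"
      by (simp add: moment_def)
    fix a assume "a \<in> {abs_sq e v |v. v \<in> S \<and> norm v = 1}"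
    then obtain v where v: "v \<in> S" "norm v = 1" and a: "a = abs_sq e v"
      by blast
    have "bounded_linear (\<lambda>x. orth_proj S x - orth_proj V x)"
      using S(1) V by (intro bounded_linear_sub bounded_linear_orth_proj)
    \<comment> \<open>Since \<open>v\<close> is a unit vector fixed by \<open>orth_proj S\<close>,
      the operator norm bounds its distance to \<open>orth_proj V v\<close>.\<close>
    from onorm[OF this, of v] have "norm (v - orth_proj V v) \<le> ?d"
      using v S(1) by (simp add: orth_proj_ident)
    then show "\<exists>b\<in>moment e V. norm (a - b) \<le> 3 * ?d"
      using ex_near_in_moment[OF e V v(2) _ d] unfolding a by blast
  qed
qed

theorem proposition6p6:
  fixes e :: "'n::finite \<Rightarrow> complex ^ 'n"
    and S V :: "(complex ^ 'n) set"
  assumes "is_orthonormal_basis e"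
    and "vec.subspace S" and "{0} \<subset> S" and "S \<subset> UNIV"
    and "vec.subspace V" and "{0} \<subset> V" and "V \<subset> UNIV"
    and "onorm (\<lambda>x. orth_proj S x - orth_proj V x) < 1 / (2 * real CARD('n))"
  shows "hausdorff_dist (moment e S) (moment e V) =
           max (SUP x\<in>moment e S. infdist x (moment e V))
               (SUP z\<in>moment e V. infdist z (moment e S)) \<and>
         hausdorff_dist (moment e S) (moment e V)
           \<le> (2 * sqrt (real CARD('n)) + 1) * onorm (\<lambda>x. orth_proj S x - orth_proj V x)"
proof -
  let ?d = "onorm (\<lambda>x. orth_proj S x - orth_proj V x)"
  have n: "1 \<le> real CARD('n)"
    by (simp add: Suc_leI)
  then have "1 < 2 * real CARD('n)"
    by linarith
  then have "1 / (2 * real CARD('n)) < 1"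
    by (simp only: divide_less_eq_1) simp
  with assms(8) have d: "?d < 1"
    by linarith
  \<comment> \<open>The operator norm is unchanged under negation, so the one-sided bound also
    applies with \<open>S\<close> and \<open>V\<close> exchanged.\<close>
  have swap: "onorm (\<lambda>x. orth_proj V x - orth_proj S x) = ?d"
    using onorm_neg[of "\<lambda>x. orth_proj S x - orth_proj V x"] by simp
  have "(SUP x\<in>moment e S. infdist x (moment e V)) \<le> 3 * ?d"
    using assms d by (intro SUP_infdist_moment_le)
  moreover have "(SUP z\<in>moment e V. infdist z (moment e S)) \<le> 3 * ?d"
    using SUP_infdist_moment_le[of e V S] assms d by (simp add: swap)
  moreover have "3 * ?d \<le> (2 * sqrt (real CARD('n)) + 1) * ?d"
  proof (rule mult_right_mono)
    show "0 \<le> ?d"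
      using assms by (intro onorm_pos_le bounded_linear_sub bounded_linear_orth_proj)
  qed (use n in simp)
  ultimately show ?thesis
    by (simp add: hausdorff_dist_def)
qed

end
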